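(* Suppose that the stochastic variational formulation is well-defined, and that $u\in L^2(\Omega;X)$ solves it, i.e. $\mathfrak{A}u=\mathfrak{L}$ in $L^2(\Omega;Y)^*$. Then $u$ solves the second-order moment variational formulation, i.e. $u \in L^2(\Omega;X)$ and $\mathcal{A}_{c(\omega)}u(\omega)=\mathcal{L}_{c(\omega)}$ in $Y^*$ almost surely.
   Context: $(\Omega,\mathcal{F},\mathbb{P})$ is a complete probability space; $X$ and $Y$ are separable Banach spaces over $\mathbb{F}\in\{\mathbb{R},\mathbb{C}\}$; $Y^*$ is the dual of $Y$ (functionals being linear, or antilinear throughout in the sesquilinear setting); $B(X,Y^* )$ is the space of bounded linear maps $X\to Y^*$; $\mathcal{C}$ is a topological space. Maps $c:\Omega\to\mathcal{C}$, $\mathcal{A}:\mathcal{C}\to B(X,Y^* )$, $\mathcal{L}:\mathcal{C}\to Y^*$ are given, and $\mathcal{A}_{c(\omega)}:=(\mathcal{A}\circ c)(\omega)$, $\mathcal{L}_{c(\omega)}:=(\mathcal{L}\circ c)(\omega)$. "Almost surely" means for $\mathbb{P}$-almost every $\omega$, and $L^p(\Omega;V)$ is the Bochner space. For $v_1\in L^2(\Omega;X)$, $v_2\in L^2(\Omega;Y)$, $$[\mathfrak{A}(v_1)](v_2)=\int_\Omega[\mathcal{A}_{c(\omega)}v_1(\omega)](v_2(\omega))\,d\mathbb{P}(\omega),\qquad\mathfrak{L}(v_2)=\int_\Omega\mathcal{L}_{c(\omega)}(v_2(\omega))\,d\mathbb{P}(\omega).$$ The stochastic variational formulation (find $u\in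 L^2(\Omega;X)$ with $\mathfrak{A}u=\mathfrak{L}$ in $L^2(\Omega;Y)^*$) is "well-defined" if for all $v_1\in L^2(\Omega;X)$ and $v_2\in L^2(\Omega;Y)$ the two integrands are Bochner integrable over $\Omega$ (so the integrals exist and are finite), and $\mathfrak{A}(v_1)\in L^2(\Omega;Y)^*$, $\mathfrak{L}\in L^2(\Omega;Y)^*$. *)

theory Defs
  imports "HOL-Probability.Probability"
begin

text \<open>
  The class captures exactly the scalar fields \<open>\<real>\<close> and \<open>\<complex>\<close>: its members are identified, as normed
  fields, with one of the two subfields \<open>\<real>\<close> and \<open>\<complex>\<close> of the complex numbers.
\<close>

class rc_field = real_normed_field + banach + second_countable_topology +
  fixes to_complex :: "'a \<Rightarrow> complex"
  assumes to_complex_add: "to_complex (a + b) = to_complex a + to_complex b"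
    and to_complex_mult: "to_complex (a * b) = to_complex a * to_complex b"
    and to_complex_scaleR: "to_complex (r *\<^sub>R a) = r *\<^sub>R to_complex a"
    and norm_to_complex: "norm (to_complex a) = norm a"
    and range_to_complex: "range to_complex = \<real> \<or> range to_complex = UNIV"

instantiation real :: rc_field
begin
definition to_complex_real :: "real \<Rightarrow> complex" where "to_complex_real = complex_of_real"
instance
  by standard (auto simp: to_complex_real_def scaleR_conv_of_real Reals_def)
end

instantiation complex :: rc_field
begin
definition to_complex_complex :: "complex \<Rightarrow> complex" where "to_complex_complex = (\<lambda>z. z)"
instance
  by standard (auto simp: to_complex_complex_def)
end

definition rc_cnj :: "'f::rc_field \<Rightarrow> 'f" where
  "rc_cnj a = inv to_complex (cnj (to_complex a))"

lemma inj_to_complex: "inj (to_complex :: 'f::rc_field \<Rightarrow> complex)"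
proof (rule injI)
  fix a b :: 'f assume eq: "to_complex a = to_complex b"
  have "to_complex (a - b) + to_complex b = to_complex a"
    by (simp flip: to_complex_add)
  with eq have "norm (to_complex (a - b)) = 0" by simp
  then show "a = b" by (simp add: norm_to_complex)
qed

lemma to_complex_rc_cnj: "to_complex (rc_cnj a) = cnj (to_complex a)"
proof -
  have "cnj (to_complex a) \<in> range (to_complex :: 'a \<Rightarrow> complex)"
  proof (cases "range (to_complex :: 'a \<Rightarrow> complex) = \<real>")
    case True
    then have "to_complex a \<in> \<real>" by blast
    then show ?thesis by (metis Reals_cnj_iff rangeI)
  next
    case False
    then show ?thesis using range_to_complex[where 'a = 'a] by simp
  qed
  then show ?thesis by (simp add: rc_cnj_def f_inv_into_f)
qed

lemma rc_cnj_real: "rc_cnj (a :: real) = a"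
  using to_complex_rc_cnj[of a] by (simp add: to_complex_real_def)

lemma rc_cnj_complex: "rc_cnj (z :: complex) = cnj z"
  using to_complex_rc_cnj[of z] by (simp add: to_complex_complex_def)

text \<open>
  A Banach space over the field \<open>'f\<close>: the type \<open>'x\<close> carries the underlying real Banach space, and
  \<open>scale\<close> extends its scalar multiplication to \<open>'f\<close>.
\<close>

locale banach_over = vector_space scale
  for scale :: "'f::rc_field \<Rightarrow> 'x::banach \<Rightarrow> 'x" +
  assumes scale_of_real: "scale (of_real r) x = r *\<^sub>R x"
    and norm_scale: "norm (scale a x) = norm a * norm x"

text \<open>
  In all that follows, \<open>\<sigma>\<close> is either the identity or \<^const>\<open>rc_cnj\<close>; it decides whether functionals are
  linear or antilinear. Elements of \<open>'y \<Rightarrow>\<^sub>L 'f\<close> are additive, real-linear and bounded, so only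
  homogeneity over \<open>'f\<close> remains to be required.
\<close>

definition dual_space :: "('f \<Rightarrow> 'f) \<Rightarrow> ('f \<Rightarrow> 'y \<Rightarrow> 'y) \<Rightarrow> ('y::banach \<Rightarrow>\<^sub>L 'f::rc_field) set" where
  "dual_space \<sigma> sY = {f. \<forall>a y. blinfun_apply f (sY a y) = \<sigma> a * f y}"

text \<open>
  The bounded linear maps from X to Y*. Scalars act pointwise on Y*, also when its elements are
  antilinear.
\<close>

definition bounded_maps_to_dual ::
  "('f \<Rightarrow> 'f) \<Rightarrow> ('f \<Rightarrow> 'x \<Rightarrow> 'x) \<Rightarrow> ('f \<Rightarrow> 'y \<Rightarrow> 'y) \<Rightarrow>
    ('x::banach \<Rightarrow>\<^sub>L 'y::banach \<Rightarrow>\<^sub>L 'f::rc_field) set" where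
  "bounded_maps_to_dual \<sigma> sX sY =
    {T. (\<forall>x. blinfun_apply T x \<in> dual_space \<sigma> sY) \<and> (\<forall>a x y. T (sX a x) y = a * T x y)}"

text \<open>
  The Bochner space is represented by square-integrable functions rather than their classes modulo
  almost everywhere equality. As the target is separable, Borel and strong measurability coincide.
\<close>

definition L2 :: "'w measure \<Rightarrow> ('w \<Rightarrow> 'v::{banach, second_countable_topology}) set" where
  "L2 M = {v \<in> borel_measurable M. integrable M (\<lambda>\<omega>. (norm (v \<omega>))\<^sup>2)}"

definition L2_norm :: "'w measure \<Rightarrow> ('w \<Rightarrow> 'v::{banach, second_countable_topology}) \<Rightarrow> real" where
  "L2_norm M v = sqrt (\<integral>\<omega>. (norm (v \<omega>))\<^sup>2 \<partial>M)"

text \<open>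
  The dual of the Bochner space. Additivity and the norm bound make each member invariant under
  almost everywhere equality, so that it is a functional on the classes; two members are
  the same functional iff they agree on \<^const>\<open>L2\<close>.
\<close>

definition L2_dual ::
  "('f \<Rightarrow> 'f) \<Rightarrow> ('f \<Rightarrow> 'y \<Rightarrow> 'y) \<Rightarrow> 'w measure \<Rightarrow>
    (('w \<Rightarrow> 'y::{banach, second_countable_topology}) \<Rightarrow> 'f::rc_field) set" where
  "L2_dual \<sigma> sY M = {\<Phi>.
     (\<forall>v\<in>L2 M. \<forall>w\<in>L2 M. \<Phi> (\<lambda>\<omega>. v \<omega> + w \<omega>) = \<Phi> v + \<Phi> w) \<and>
     (\<forall>a. \<forall>v\<in>L2 M. \<Phi> (\<lambda>\<omega>. sY a (v \<omega>)) = \<sigma> a * \<Phi> v) \<and>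
     (\<exists>K. \<forall>v\<in>L2 M. norm (\<Phi> v) \<le> K * L2_norm M v)}"

definition stoch_form ::
  "'w measure \<Rightarrow> ('w \<Rightarrow> 'c) \<Rightarrow> ('c \<Rightarrow> 'x::banach \<Rightarrow>\<^sub>L 'y::banach \<Rightarrow>\<^sub>L 'f::rc_field) \<Rightarrow>
    ('w \<Rightarrow> 'x) \<Rightarrow> ('w \<Rightarrow> 'y) \<Rightarrow> 'f" where
  "stoch_form M c \<A> v1 v2 = (\<integral>\<omega>. \<A> (c \<omega>) (v1 \<omega>) (v2 \<omega>) \<partial>M)"

definition stoch_functional ::
  "'w measure \<Rightarrow> ('w \<Rightarrow> 'c) \<Rightarrow> ('c \<Rightarrow> 'y::banach \<Rightarrow>\<^sub>L 'f::rc_field) \<Rightarrow> ('w \<Rightarrow> 'y) \<Rightarrow> 'f" where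
  "stoch_functional M c \<L> v2 = (\<integral>\<omega>. \<L> (c \<omega>) (v2 \<omega>) \<partial>M)"

definition svf_well_defined ::
  "('f \<Rightarrow> 'f) \<Rightarrow> ('f \<Rightarrow> 'y \<Rightarrow> 'y) \<Rightarrow> 'w measure \<Rightarrow> ('w \<Rightarrow> 'c) \<Rightarrow>
    ('c \<Rightarrow> 'x::{banach, second_countable_topology} \<Rightarrow>\<^sub>L
      'y::{banach, second_countable_topology} \<Rightarrow>\<^sub>L 'f::rc_field) \<Rightarrow>
    ('c \<Rightarrow> 'y \<Rightarrow>\<^sub>L 'f) \<Rightarrow> bool" where
  "svf_well_defined \<sigma> sY M c \<A> \<L> \<longleftrightarrow>
     (\<forall>v1\<in>L2 M. \<forall>v2\<in>L2 M.
        integrable M (\<lambda>\<omega>. \<A> (c \<omega>) (v1 \<omega>) (v2 \<omega>)) \<and> integrable M (\<lambda>\<omega>. \<L> (c \<omega>) (v2 \<omega>))) \<and>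
     (\<forall>v1\<in>L2 M. stoch_form M c \<A> v1 \<in> L2_dual \<sigma> sY M) \<and>
     stoch_functional M c \<L> \<in> L2_dual \<sigma> sY M"

definition solves_svf ::
  "'w measure \<Rightarrow> ('w \<Rightarrow> 'c) \<Rightarrow>
    ('c \<Rightarrow> 'x::{banach, second_countable_topology} \<Rightarrow>\<^sub>L
      'y::{banach, second_countable_topology} \<Rightarrow>\<^sub>L 'f::rc_field) \<Rightarrow>
    ('c \<Rightarrow> 'y \<Rightarrow>\<^sub>L 'f) \<Rightarrow> ('w \<Rightarrow> 'x) \<Rightarrow> bool" where
  "solves_svf M c \<A> \<L> u \<longleftrightarrow>
     u \<in> L2 M \<and> (\<forall>v2\<in>L2 M. stoch_form M c \<A> u v2 = stoch_functional M c \<L> v2)"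

definition solves_second_moment_vf ::
  "'w measure \<Rightarrow> ('w \<Rightarrow> 'c) \<Rightarrow>
    ('c \<Rightarrow> 'x::{banach, second_countable_topology} \<Rightarrow>\<^sub>L
      'y::{banach, second_countable_topology} \<Rightarrow>\<^sub>L 'f::rc_field) \<Rightarrow>
    ('c \<Rightarrow> 'y \<Rightarrow>\<^sub>L 'f) \<Rightarrow> ('w \<Rightarrow> 'x) \<Rightarrow> bool" where
  "solves_second_moment_vf M c \<A> \<L> u \<longleftrightarrow>
     u \<in> L2 M \<and> (AE \<omega> in M. \<A> (c \<omega>) (u \<omega>) = \<L> (c \<omega>))"

end

theory Submission
  imports Defs
begin

text \<open>
  Testing the equation with \<open>\<omega> \<mapsto> indicator E \<omega> *\<^sub>R y\<close>, for a fixed \<open>y\<close> and a measurable set \<open>E\<close>, shows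
  that the integrable functions \<open>\<omega> \<mapsto> \<A> (c \<omega>) (u \<omega>) y\<close> and \<open>\<omega> \<mapsto> \<L> (c \<omega>) y\<close> have the same integral over
  every measurable set, so they agree almost everywhere (\<open>density_unique_banach\<close>). The
  exceptional null set depends on \<open>y\<close>; as \<open>Y\<close> is separable, a single null set serves all \<open>y\<close> in a
  countable dense set, and continuity of the functionals extends the equality to all of \<open>Y\<close>
  (\<open>AE_blinfun_eqI\<close>).
\<close>

lemma indicator_scaleR_in_L2:
  assumes "finite_measure M" and "E \<in> sets M"
  shows "(\<lambda>\<omega>. indicator E \<omega> *\<^sub>R y) \<in> L2 M"
proof -
  interpret finite_measure M by fact
  have "(\<lambda>\<omega>. (norm (indicator E \<omega> *\<^sub>R y))\<^sup>2) = (\<lambda>\<omega>. indicator E \<omega> *\<^sub>R (norm y)\<^sup>2)"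
    by (auto split: split_indicator)
  with assms(2) show ?thesis
    by (simp add: L2_def integrable_real_indicator less_top[symmetric])
qed

lemma AE_blinfun_eqI:
  fixes F G :: "'w \<Rightarrow> 'y::{real_normed_vector, second_countable_topology} \<Rightarrow>\<^sub>L 'f::real_normed_vector"
  assumes ae: "\<And>y. AE \<omega> in M. F \<omega> y = G \<omega> y"
  shows "AE \<omega> in M. F \<omega> = G \<omega>"
proof -
  obtain D :: "'y set" where "countable D"
    and dense: "\<And>U. open U \<Longrightarrow> U \<noteq> {} \<Longrightarrow> \<exists>d\<in>D. d \<in> U"
    by (rule countable_dense_setE) blast
  then have "AE \<omega> in M. \<forall>y\<in>D. F \<omega> y = G \<omega> y"
    using ae by (simp add: AE_ball_countable)
  then show ?thesis
  proof (rule AE_mp, intro AE_I2 impI)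
    fix \<omega> assume eq: "\<forall>y\<in>D. F \<omega> y = G \<omega> y"
    \<comment> \<open>The set where the two functionals differ is open and misses \<open>D\<close>, hence empty.\<close>
    have "open {y. F \<omega> y \<noteq> G \<omega> y}"
      by (intro open_Collect_neq continuous_intros)
    with dense eq have "{y. F \<omega> y \<noteq> G \<omega> y} = {}" by blast
    then show "F \<omega> = G \<omega>" by (auto intro: blinfun_eqI)
  qed
qed

theorem theorem2p9:
  fixes M :: "'w measure"
    and sX :: "'f::rc_field \<Rightarrow> 'x::{banach, second_countable_topology} \<Rightarrow> 'x"
    and sY :: "'f \<Rightarrow> 'y::{banach, second_countable_topology} \<Rightarrow> 'y"
    and \<sigma> :: "'f \<Rightarrow> 'f"
    and c :: "'w \<Rightarrow> 'c::topological_space"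
    and \<A> :: "'c \<Rightarrow> 'x \<Rightarrow>\<^sub>L 'y \<Rightarrow>\<^sub>L 'f"
    and \<L> :: "'c \<Rightarrow> 'y \<Rightarrow>\<^sub>L 'f"
    and u :: "'w \<Rightarrow> 'x"
  assumes "prob_space M" and "complete_measure M"
    and "banach_over sX" and "banach_over sY"
    and "\<sigma> = (\<lambda>a. a) \<or> \<sigma> = rc_cnj"
    and "\<And>k. \<A> k \<in> bounded_maps_to_dual \<sigma> sX sY"
    and "\<And>k. \<L> k \<in> dual_space \<sigma> sY"
    and "svf_well_defined \<sigma> sY M c \<A> \<L>"
    and "solves_svf M c \<A> \<L> u"
  shows "solves_second_moment_vf M c \<A> \<L> u"
proof -
  interpret prob_space M by fact
  have int_A: "integrable M (\<lambda>\<omega>. \<A> (c \<omega>) (u \<omega>) (v \<omega>))"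
    and int_L: "integrable M (\<lambda>\<omega>. \<L> (c \<omega>) (v \<omega>))"
    and eq: "(\<integral>\<omega>. \<A> (c \<omega>) (u \<omega>) (v \<omega>) \<partial>M) = (\<integral>\<omega>. \<L> (c \<omega>) (v \<omega>) \<partial>M)"
    if "v \<in> L2 M" for v
    using that assms(8,9)
    by (auto simp: svf_well_defined_def solves_svf_def stoch_form_def stoch_functional_def)
  have "AE \<omega> in M. \<A> (c \<omega>) (u \<omega>) y = \<L> (c \<omega>) y" for y
  proof (rule density_unique_banach)
    have "(\<lambda>\<omega>. y) \<in> L2 M" by (simp add: L2_def)
    from int_A[OF this] int_L[OF this]
    show "integrable M (\<lambda>\<omega>. \<A> (c \<omega>) (u \<omega>) y)" "integrable M (\<lambda>\<omega>. \<L> (c \<omega>) y)" .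
  next
    fix E assume "E \<in> sets M"
    from eq[OF indicator_scaleR_in_L2[OF finite_measure_axioms this]]
    show "(LINT \<omega>:E|M. \<A> (c \<omega>) (u \<omega>) y) = (LINT \<omega>:E|M. \<L> (c \<omega>) y)"
      by (simp add: set_lebesgue_integral_def blinfun.scaleR_right)
  qed
  then have "AE \<omega> in M. \<A> (c \<omega>) (u \<omega>) = \<L> (c \<omega>)"
    by (rule AE_blinfun_eqI)
  with assms(9) show ?thesis
    by (simp add: solves_second_moment_vf_def solves_svf_def)
qed

end
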